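(* For every interval $[\alpha,\beta]\subseteq(0,1]$, \[\lambda\bigl(F^{-(n-1)}[\alpha,\beta]\bigr)=\frac{\log(\beta/\alpha)}{\log n}\left(1+O_{\alpha,\beta}\!\left(\frac{1}{\log n}\right)\right)\qquad(n\to\infty),\] where the implied constant depends only on $\alpha,\beta$.
   Context: $\lambda$ denotes Lebesgue measure on $[0,1]$. $F:[0,1]\to[0,1]$ is the Farey map, $F(x)=x/(1-x)$ for $0\le x\le 1/2$ and $F(x)=(1-x)/x$ for $1/2<x\le 1$. $F^{-k}$ denotes the preimage under the $k$-th iterate of $F$. $f=O_{a}(g)$ means $|f|\le M|g|$ for all sufficiently large arguments, with $M$ and the threshold depending on $a$. *)

theory Defs
  imports "HOL-Analysis.Analysis" "HOL-Library.Landau_Symbols"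
begin

definition farey :: "real \<Rightarrow> real" where
  "farey x = (if x \<le> 1/2 then x / (1 - x) else (1 - x) / x)"

definition farey_preimage :: "nat \<Rightarrow> real set \<Rightarrow> real set" where
  "farey_preimage k A = {x \<in> {0..1}. (farey ^^ k) x \<in> A}"

end

theory Submission
  imports Defs "HOL-Real_Asymp.Real_Asymp"
begin

text \<open>
  Let \<open>g\<^sub>n(x) / x\<close> be the density of the push-forward of Lebesgue measure under the \<open>n\<close>-th iterate of
  the Farey map, so that \<open>g\<^sub>n\<close> is the \<open>n\<close>-th image of the identity under the transfer operator of
  the infinite invariant measure \<open>dx / x\<close>. This operator preserves the cone of nonnegative increasing
  concave functions; hence \<open>a\<^sub>n = g\<^sub>n(1)\<close> decreases and \<open>a\<^sub>n\<^sub>+\<^sub>1 = g\<^sub>n(1/2) \<le> g\<^sub>n \<le> a\<^sub>n\<close> on \<open>[1/2, 1]\<close>.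
  Splitting \<open>[0,1]\<close> according to the last visit to \<open>(1/2, 1]\<close> before time \<open>n\<close> gives the
  renewal equation
  \<open>n / (n + 1) = (\<Sum>k=1..n. \<integral> g\<^sub>n\<^sub>-\<^sub>k(y) / y dy over [k / (k + 1), 1])\<close>.
  Since the weights \<open>ln ((k + 1) / k)\<close> add up to \<open>ln (n + 1)\<close>, monotonicity gives
  \<open>a\<^sub>n ln (n + 1) \<le> 1\<close>; using this bound to control the terms \<open>k > n / 2\<close>, the same
  equation gives \<open>a\<^sub>n = 1 / ln n + O(1 / (ln n)\<^sup>2)\<close>. The recursion for \<open>g\<^sub>n\<close> at \<open>1 / k\<close> then carries this
  expansion from \<open>1 / k\<close> to \<open>1 / (k + 1)\<close>, hence uniformly to every \<open>[\<alpha>, \<beta>]\<close>.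
\<close>

text \<open>The density with respect to \<open>dx / x\<close>, not with respect to Lebesgue measure.\<close>

primrec farey_density :: "nat \<Rightarrow> real \<Rightarrow> real" where
  "farey_density 0 x = x"
| "farey_density (Suc n) x =
     (farey_density n (x / (1 + x)) + x * farey_density n (1 / (1 + x))) / (1 + x)"

section \<open>The invariant cone of the transfer operator\<close>

text \<open>The product \<open>(1 - p) * g p\<close> has nonnegative concave factors of opposite
  monotonicity, hence is concave; the other summand is its reflection under \<open>p\<close> to
  \<open>1 - p\<close>.\<close>

lemma concave_on_symmetrization:
  fixes g :: "real \<Rightarrow> real"
  assumes conc: "concave_on {0..1} g" and mono: "mono_on {0..1} g" and "\<And>x. x \<in> {0..1} \<Longrightarrow> 0 \<le> g x"
  shows "concave_on {0..1} (\<lambda>p. p * g (1 - p) + (1 - p) * g p)"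
proof -
  have "concave_on {0..1} (\<lambda>p. g p * (1 - p))"
  proof (rule concave_on_mul)
    show "concave_on {0..1} (\<lambda>p::real. 1 - p)"
      by (auto simp: concave_on_iff algebra_simps)
    show "monotone_on {0..1} (\<le>) (\<ge>) (\<lambda>p::real. 1 - p)"
      by (auto simp: monotone_on_def)
    show "mono_on {0..1} g" by fact
  qed (use assms in auto)
  then have main: "concave_on {0..1} (\<lambda>p. (1 - p) * g p)"
    by (simp add: mult.commute)
  have "concave_on {0..1} (\<lambda>p. (1 - (1 - p)) * g (1 - p))"
    unfolding concave_on_iff
  proof (intro conjI ballI allI impI)
    fix x y u v :: real
    assume *: "x \<in> {0..1}" "y \<in> {0..1}" "0 \<le> u" "0 \<le> v" "u + v = 1"
    have eq: "1 - (u *\<^sub>R x + v *\<^sub>R y) = u *\<^sub>R (1 - x) + v *\<^sub>R (1 - y)"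
      using \<open>u + v = 1\<close> by (simp add: algebra_simps)
    have "1 - x \<in> {0..1}" "1 - y \<in> {0..1}" using * by auto
    then show "u * ((1 - (1 - x)) * g (1 - x)) + v * ((1 - (1 - y)) * g (1 - y))
       \<le> (1 - (1 - (u *\<^sub>R x + v *\<^sub>R y))) * g (1 - (u *\<^sub>R x + v *\<^sub>R y))"
      unfolding eq using main * unfolding concave_on_iff by blast
  qed auto
  from concave_on_add[OF this main] show ?thesis by simp
qed

text \<open>The point \<open>p\<close> lies between \<open>1 - q\<close> and \<open>q\<close>, where
  \<open>h\<close> takes equal values, so concavity puts \<open>h p\<close> above
  \<open>h q\<close>.\<close>

lemma concave_symmetric_antimono:
  fixes h :: "real \<Rightarrow> real"
  assumes conc: "concave_on {0..1} h" and sym: "\<And>p. h (1 - p) = h p"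
    and "1/2 \<le> p" "p \<le> q" "q \<le> 1"
  shows "h q \<le> h p"
proof (cases "p = q")
  case False
  define v where "v = (p - (1 - q)) / (2 * q - 1)"
  have q: "2 * q - 1 > 0" using False assms by auto
  have v: "0 \<le> v" "v \<le> 1" using q assms by (auto simp: v_def field_simps)
  have "v * (2 * q - 1) = p - (1 - q)" using q by (simp add: v_def)
  then have p: "p = (1 - v) *\<^sub>R (1 - q) + v *\<^sub>R q" by (simp add: algebra_simps)
  have "(1 - v) * h (1 - q) + v * h q \<le> h p"
    unfolding p using assms v by (intro concave_onD[OF conc]) auto
  then show ?thesis by (simp add: sym algebra_simps)
qed simp

lemma inverse_one_plus_convex:
  fixes x y u v :: real
  assumes "x \<ge> 0" "y \<ge> 0" "u \<ge> 0" "v \<ge> 0" "u + v = 1"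
  shows "1 / (1 + (u * x + v * y)) \<le> u * (1 / (1 + x)) + v * (1 / (1 + y))"
proof -
  have u: "u = 1 - v" using assms by simp
  have pos: "1 + (u * x + v * y) > 0" using assms by (simp add: add_pos_nonneg)
  \<comment> \<open>The convexity defect is an explicit square over a positive product.\<close>
  have "u * (1 / (1 + x)) + v * (1 / (1 + y)) - 1 / (1 + (u * x + v * y))
      = u * v * (x - y)^2 / ((1 + x) * (1 + y) * (1 + (u * x + v * y)))"
    using assms(1,2) pos unfolding u by (simp add: divide_simps) algebra
  also have "\<dots> \<ge> 0" using assms pos by (intro divide_nonneg_pos mult_pos_pos) auto
  finally show ?thesis by simp
qed

text \<open>The three properties are carried together: monotonicity of the next density comes from
  concavity of the symmetrization, which in turn draws on all three.\<close>

lemma farey_density_mono_concave: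
  "mono_on {0..1} (farey_density n) \<and> concave_on {0..1} (farey_density n) \<and>
    (\<forall>x\<in>{0..1}. 0 \<le> farey_density n x)"
proof (induction n)
  case 0
  show ?case by (auto simp: mono_on_def concave_on_iff)
next
  case (Suc n)
  txt \<open>The image of \<open>g\<close> is \<open>h \<circ> (\<lambda>x. 1 / (1 + x))\<close>, a concave decreasing function after a convex one.\<close>
  define h where "h p = p * farey_density n (1 - p) + (1 - p) * farey_density n p" for p
  have conc: "concave_on {0..1} h"
    unfolding h_def using Suc by (intro concave_on_symmetrization) auto
  have sym: "h (1 - p) = h p" for p by (simp add: h_def)
  note anti = concave_symmetric_antimono[OF conc sym]
  have eq: "farey_density (Suc n) x = h (1 / (1 + x))" if "x \<in> {0..1}" for x
  proof -
    have *: "1 - 1 / (1 + x) = x / (1 + x)" using that by (simp add: field_simps)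
    then show ?thesis unfolding h_def * by (simp add: add_divide_distrib)
  qed
  have "mono_on {0..1} (farey_density (Suc n))"
  proof (rule mono_onI)
    fix x y :: real assume *: "x \<in> {0..1}" "y \<in> {0..1}" "x \<le> y"
    then have "h (1 / (1 + x)) \<le> h (1 / (1 + y))"
      by (intro anti) (auto simp: field_simps)
    then show "farey_density (Suc n) x \<le> farey_density (Suc n) y" using * by (simp only: eq)
  qed
  moreover have "concave_on {0..1} (farey_density (Suc n))"
    unfolding concave_on_iff
  proof (intro conjI ballI allI impI)
    fix x y u v :: real
    assume *: "x \<in> {0..1}" "y \<in> {0..1}" "0 \<le> u" "0 \<le> v" "u + v = 1"
    have in01: "u *\<^sub>R x + v *\<^sub>R y \<in> {0..1}"
      using * convexD[of "{0..1::real}"] by (metis convex_real_interval(5))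
    have r: "1 / (1 + x) \<in> {1/2..1}" "1 / (1 + y) \<in> {1/2..1}" using * by (auto simp: field_simps)
    then have r': "u *\<^sub>R (1 / (1 + x)) + v *\<^sub>R (1 / (1 + y)) \<in> {1/2..1}"
      using * convexD[of "{1/2..1::real}"] by (metis convex_real_interval(5))
    have "u * h (1 / (1 + x)) + v * h (1 / (1 + y)) \<le> h (u *\<^sub>R (1 / (1 + x)) + v *\<^sub>R (1 / (1 + y)))"
    proof -
      have "1 / (1 + x) \<in> {0..1}" "1 / (1 + y) \<in> {0..1}" using * by auto
      then show ?thesis using conc * unfolding concave_on_iff by blast
    qed
    also have "\<dots> \<le> h (1 / (1 + (u *\<^sub>R x + v *\<^sub>R y)))"
    proof (rule anti)
      show "1 / 2 \<le> 1 / (1 + (u *\<^sub>R x + v *\<^sub>R y))" using in01 by (simp add: field_simps)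
    qed (use inverse_one_plus_convex[of x y u v] * r' in auto)
    finally show "u * farey_density (Suc n) x + v * farey_density (Suc n) y
        \<le> farey_density (Suc n) (u *\<^sub>R x + v *\<^sub>R y)"
      using * in01 by (simp only: eq)
  qed auto
  moreover have "0 \<le> farey_density (Suc n) x" if "x \<in> {0..1}" for x
  proof -
    have "x / (1 + x) \<in> {0..1}" "1 / (1 + x) \<in> {0..1}" using that by (auto simp: field_simps)
    then show ?thesis using Suc that by auto
  qed
  ultimately show ?case by blast
qed

lemma farey_density_nonneg: "0 \<le> x \<Longrightarrow> x \<le> 1 \<Longrightarrow> 0 \<le> farey_density n x"
  using farey_density_mono_concave by auto

lemma farey_density_mono: "0 \<le> x \<Longrightarrow> x \<le> y \<Longrightarrow> y \<le> 1 \<Longrightarrow> farey_density n x \<le> farey_density n y"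
  using farey_density_mono_concave[of n] by (auto intro: mono_onD)

text \<open>Both inverse branches send 1 to 1/2. This turns monotonicity in the point into
  monotonicity in \<open>n\<close>.\<close>

lemma farey_density_half: "farey_density n (1/2) = farey_density (Suc n) 1"
  by simp

lemma farey_density_one_antimono: "m \<le> n \<Longrightarrow> farey_density n 1 \<le> farey_density m 1"
proof (induction rule: dec_induct)
  case (step k)
  then show ?case
    using farey_density_mono[of "1/2" 1 k] unfolding farey_density_half by simp
qed simp

section \<open>Push-forward of Lebesgue measure under the iterates\<close>

lemma borel_measurable_farey_density [measurable]: "farey_density n \<in> borel_measurable borel"
proof (induction n)
  case (Suc n)
  note [measurable] = Suc
  show ?case by simp
qed simp

lemma borel_measurable_farey [measurable]: "farey \<in> borel_measurable borel"
  unfolding farey_def[abs_def] by measurable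

lemma nn_integral_farey_left:
  fixes f :: "real \<Rightarrow> ennreal"
  assumes [measurable]: "f \<in> borel_measurable borel"
  shows "(\<integral>\<^sup>+x. f x * indicator {0..1/2} x \<partial>lborel) =
         (\<integral>\<^sup>+x. f (x / (1 + x)) * ennreal (1 / (1 + x)\<^sup>2) * indicator {0..1} x \<partial>lborel)"
proof -
  have "((\<lambda>x. x / (1 + x)) has_real_derivative 1 / (1 + x)\<^sup>2) (at x)" if "x \<in> {0..1}" for x :: real
    using that by (auto intro!: derivative_eq_intros simp: power2_eq_square)
  moreover have "continuous_on {0..1} (\<lambda>x::real. 1 / (1 + x)\<^sup>2)"
    by (auto intro!: continuous_intros)
  ultimately show ?thesis
    using nn_integral_substitution_aux[of f 0 1 "\<lambda>x. x / (1 + x)" "\<lambda>x. 1 / (1 + x)\<^sup>2"] by simp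
qed

lemma nn_integral_farey_right:
  fixes f :: "real \<Rightarrow> ennreal"
  assumes [measurable]: "f \<in> borel_measurable borel"
  shows "(\<integral>\<^sup>+x. f x * indicator {1/2..1} x \<partial>lborel) =
         (\<integral>\<^sup>+x. f (1 / (1 + x)) * ennreal (1 / (1 + x)\<^sup>2) * indicator {0..1} x \<partial>lborel)"
proof -
  \<comment> \<open>The branch \<open>1 / (1 + x)\<close> is decreasing, but the substitution rule
    applied below takes a nonnegative derivative. So the branch is first composed with
    \<open>1 - x\<close>, and the reflection is undone afterwards.\<close>
  have "((\<lambda>x. 1 / (2 - x)) has_real_derivative 1 / (2 - x)\<^sup>2) (at x)" if "x \<in> {0..1}" for x :: real
    using that by (auto intro!: derivative_eq_intros simp: power2_eq_square)
  moreover have "continuous_on {0..1} (\<lambda>x::real. 1 / (2 - x)\<^sup>2)"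
    by (auto intro!: continuous_intros)
  ultimately have "(\<integral>\<^sup>+x. f x * indicator {1/2..1} x \<partial>lborel) =
        (\<integral>\<^sup>+x. f (1 / (2 - x)) * ennreal (1 / (2 - x)\<^sup>2) * indicator {0..1} x \<partial>lborel)"
    using nn_integral_substitution_aux[of f 0 1 "\<lambda>x. 1 / (2 - x)" "\<lambda>x. 1 / (2 - x)\<^sup>2"] by simp
  also have "\<dots> = (\<integral>\<^sup>+x. f (1 / (1 + x)) * ennreal (1 / (1 + x)\<^sup>2) * indicator {0..1} x \<partial>lborel)"
    by (subst nn_integral_real_affine[of _ "-1" 1])
       (auto intro!: nn_integral_cong simp: algebra_simps split: split_indicator)
  finally show ?thesis .
qed

text \<open>Both inverse branches have derivative \<open>1 / (1 + x)\<^sup>2\<close> in absolute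
  value; adding their contributions reproduces the recursion of \<open>farey_density\<close>,
  rescaled by \<open>1 / x\<close>.\<close>

lemma nn_integral_farey_transfer:
  fixes u :: "real \<Rightarrow> ennreal"
  assumes [measurable]: "u \<in> borel_measurable borel"
  shows "(\<integral>\<^sup>+x. u (farey x) * ennreal (farey_density n x / x) * indicator {0..1} x \<partial>lborel) =
         (\<integral>\<^sup>+x. u x * ennreal (farey_density (Suc n) x / x) * indicator {0..1} x \<partial>lborel)"
proof -
  define f where "f x = u (farey x) * ennreal (farey_density n x / x)" for x
  have [measurable]: "f \<in> borel_measurable borel" unfolding f_def by measurable
  have pointwise: "f (x / (1 + x)) * ennreal (1 / (1 + x)\<^sup>2) + f (1 / (1 + x)) * ennreal (1 / (1 + x)\<^sup>2)
      = u x * ennreal (farey_density (Suc n) x / x)" if x: "0 < x" "x \<le> 1" for x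
  proof -
    have "farey (x / (1 + x)) = x" "farey (1 / (1 + x)) = x"
      using x by (auto simp: farey_def field_simps)
    then have "f (x / (1 + x)) * ennreal (1 / (1 + x)\<^sup>2) + f (1 / (1 + x)) * ennreal (1 / (1 + x)\<^sup>2)
      = u x * (ennreal (farey_density n (x / (1 + x)) / (x / (1 + x))) * ennreal (1 / (1 + x)\<^sup>2)
               + ennreal (farey_density n (1 / (1 + x)) / (1 / (1 + x))) * ennreal (1 / (1 + x)\<^sup>2))"
      by (simp add: f_def distrib_left mult.assoc)
    also have "\<dots> = u x * ennreal (farey_density n (x / (1 + x)) / (x / (1 + x)) * (1 / (1 + x)\<^sup>2)
               + farey_density n (1 / (1 + x)) / (1 / (1 + x)) * (1 / (1 + x)\<^sup>2))"
    proof -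
      have "0 \<le> farey_density n (x / (1 + x)) / (x / (1 + x))"
        "0 \<le> farey_density n (1 / (1 + x)) / (1 / (1 + x))"
        using x by (auto intro!: divide_nonneg_nonneg mult_nonneg_nonneg farey_density_nonneg)
      then show ?thesis by (simp only: ennreal_mult ennreal_plus mult_nonneg_nonneg zero_le_divide_1_iff zero_le_power2)
    qed
    also have "farey_density n (x / (1 + x)) / (x / (1 + x)) * (1 / (1 + x)\<^sup>2)
               + farey_density n (1 / (1 + x)) / (1 / (1 + x)) * (1 / (1 + x)\<^sup>2)
             = farey_density (Suc n) x / x"
      using x by (simp add: divide_simps power2_eq_square)
    finally show ?thesis .
  qed
  have "(\<integral>\<^sup>+x. f x * indicator {0..1} x \<partial>lborel) =
        (\<integral>\<^sup>+x. f x * indicator {0..1/2} x + f x * indicator {1/2..1} x \<partial>lborel)"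
    \<comment> \<open>The two halves overlap only in the null set consisting of 1/2.\<close>
    using AE_lborel_singleton[of "1/2::real"]
    by (intro nn_integral_cong_AE, eventually_elim) (auto split: split_indicator)
  also have "\<dots> = (\<integral>\<^sup>+x. f (x / (1 + x)) * ennreal (1 / (1 + x)\<^sup>2) * indicator {0..1} x
        + f (1 / (1 + x)) * ennreal (1 / (1 + x)\<^sup>2) * indicator {0..1} x \<partial>lborel)"
    by (simp add: nn_integral_add nn_integral_farey_left nn_integral_farey_right)
  also have "\<dots> = (\<integral>\<^sup>+x. u x * ennreal (farey_density (Suc n) x / x) * indicator {0..1} x \<partial>lborel)"
    using AE_lborel_singleton[of "0::real"]
    by (intro nn_integral_cong_AE, eventually_elim)
       (use pointwise in \<open>auto simp del: farey_density.simps split: split_indicator\<close>)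
  finally show ?thesis unfolding f_def .
qed

lemma nn_integral_farey_funpow:
  fixes u :: "real \<Rightarrow> ennreal"
  assumes "u \<in> borel_measurable borel"
  shows "(\<integral>\<^sup>+x. u ((farey ^^ n) x) * indicator {0..1} x \<partial>lborel) =
         (\<integral>\<^sup>+x. u x * ennreal (farey_density n x / x) * indicator {0..1} x \<partial>lborel)"
  using assms
proof (induction n arbitrary: u)
  case 0
  show ?case
    \<comment> \<open>The initial density \<open>x / x\<close> is 1 except at 0, where division by
      zero yields 0.\<close>
    using AE_lborel_singleton[of "0::real"]
    by (intro nn_integral_cong_AE, eventually_elim) (auto split: split_indicator)
next
  case (Suc n)
  note [measurable] = Suc.prems
  have "(\<integral>\<^sup>+x. u ((farey ^^ Suc n) x) * indicator {0..1} x \<partial>lborel) =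
        (\<integral>\<^sup>+x. u (farey x) * ennreal (farey_density n x / x) * indicator {0..1} x \<partial>lborel)"
    using Suc.IH[of "\<lambda>x. u (farey x)"] by simp
  also have "\<dots> = (\<integral>\<^sup>+x. u x * ennreal (farey_density (Suc n) x / x) * indicator {0..1} x \<partial>lborel)"
    by (rule nn_integral_farey_transfer) fact
  finally show ?case .
qed

lemma measurable_farey_funpow [measurable]: "farey ^^ n \<in> borel_measurable borel"
  by (rule measurable_compose_n) measurable

lemma farey_preimage_measurable [measurable]:
  assumes [measurable]: "A \<in> sets borel"
  shows "farey_preimage n A \<in> sets borel"
  unfolding farey_preimage_def by measurable

lemma emeasure_farey_preimage:
  assumes [measurable]: "A \<in> sets borel"
  shows "emeasure lborel (farey_preimage n A) =
         (\<integral>\<^sup>+x. ennreal (farey_density n x / x) * indicator (A \<inter> {0..1}) x \<partial>lborel)"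
proof -
  have "emeasure lborel (farey_preimage n A) = (\<integral>\<^sup>+x. indicator (farey_preimage n A) x \<partial>lborel)"
    by simp
  also have "\<dots> = (\<integral>\<^sup>+x. indicator A ((farey ^^ n) x) * indicator {0..1} x \<partial>lborel)"
    by (intro nn_integral_cong) (auto simp: farey_preimage_def split: split_indicator)
  also have "\<dots> = (\<integral>\<^sup>+x. indicator A x * ennreal (farey_density n x / x) * indicator {0..1} x \<partial>lborel)"
    by (rule nn_integral_farey_funpow) measurable
  also have "\<dots> = (\<integral>\<^sup>+x. ennreal (farey_density n x / x) * indicator (A \<inter> {0..1}) x \<partial>lborel)"
    by (intro nn_integral_cong) (auto split: split_indicator)
  finally show ?thesis .
qed

lemma farey_preimage_subset: "farey_preimage n A \<subseteq> {0..1}"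
  by (auto simp: farey_preimage_def)

lemma emeasure_farey_preimage_eq_measure:
  "emeasure lborel (farey_preimage n A) = ennreal (measure lborel (farey_preimage n A))"
proof (rule emeasure_eq_ennreal_measure)
  have "emeasure lborel (farey_preimage n A) \<le> emeasure lborel {0..1::real}"
    by (intro emeasure_mono farey_preimage_subset) simp
  then show "emeasure lborel (farey_preimage n A) \<noteq> top"
    by (auto simp: top_unique)
qed

section \<open>Logarithmic bounds for measures of preimages\<close>

lemma nn_integral_inverse_Icc:
  fixes a b c :: real
  assumes "0 < a" "a \<le> b" "0 \<le> c"
  shows "(\<integral>\<^sup>+x. ennreal (c / x) * indicator {a..b} x \<partial>lborel) = ennreal (c * ln (b / a))"
proof -
  have "(\<integral>\<^sup>+x. ennreal (c / x) * indicator {a..b} x \<partial>lborel) = ennreal (c * ln b - c * ln a)"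
  proof (rule nn_integral_FTC_Icc)
    show "((\<lambda>x. c * ln x) has_real_derivative c / x) (at x)" if "x \<in> {a..b}" for x
      using that assms by (auto intro!: derivative_eq_intros)
  qed (use assms in auto)
  then show ?thesis using assms by (simp add: ln_div algebra_simps)
qed

text \<open>By monotonicity the density on the interval lies between two multiples of
  \<open>1 / x\<close>. Agreement up to a null set lets half-open intervals be treated as
  well.\<close>

lemma measure_farey_preimage_bounds:
  assumes "0 < a" "a \<le> b" "b \<le> 1" and [measurable]: "A \<in> sets borel"
    and A: "AE x in lborel. x \<in> A \<longleftrightarrow> x \<in> {a..b}"
  shows "farey_density n a * ln (b / a) \<le> measure lborel (farey_preimage n A)"
    and "measure lborel (farey_preimage n A) \<le> farey_density n b * ln (b / a)"
proof -
  have ln: "ln (b / a) \<ge> 0" using assms by simp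
  have eq: "emeasure lborel (farey_preimage n A) =
      (\<integral>\<^sup>+x. ennreal (farey_density n x / x) * indicator {a..b} x \<partial>lborel)"
    unfolding emeasure_farey_preimage[OF \<open>A \<in> sets borel\<close>] using A
    by (intro nn_integral_cong_AE, eventually_elim) (use assms in \<open>auto split: split_indicator\<close>)
  have "ennreal (farey_density n a * ln (b / a)) =
      (\<integral>\<^sup>+x. ennreal (farey_density n a / x) * indicator {a..b} x \<partial>lborel)"
    using assms by (intro nn_integral_inverse_Icc[symmetric] farey_density_nonneg) auto
  also have "\<dots> \<le> emeasure lborel (farey_preimage n A)"
    unfolding eq using assms
    by (intro nn_integral_mono) (auto split: split_indicator intro!: ennreal_leI divide_right_mono farey_density_mono)
  finally show "farey_density n a * ln (b / a) \<le> measure lborel (farey_preimage n A)"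
    unfolding emeasure_farey_preimage_eq_measure by (simp add: ennreal_le_iff)
  have "emeasure lborel (farey_preimage n A) \<le>
      (\<integral>\<^sup>+x. ennreal (farey_density n b / x) * indicator {a..b} x \<partial>lborel)"
    unfolding eq using assms
    by (intro nn_integral_mono) (auto split: split_indicator intro!: ennreal_leI divide_right_mono farey_density_mono)
  also have "\<dots> = ennreal (farey_density n b * ln (b / a))"
    using assms by (intro nn_integral_inverse_Icc farey_density_nonneg) auto
  finally show "measure lborel (farey_preimage n A) \<le> farey_density n b * ln (b / a)"
    unfolding emeasure_farey_preimage_eq_measure
    using assms ln by (simp add: ennreal_le_iff farey_density_nonneg)
qed

section \<open>The renewal equation\<close>

lemma farey_funpow_mem_unit_interval: "x \<in> {0..1} \<Longrightarrow> (farey ^^ n) x \<in> {0..1}"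
  by (induction n) (auto simp: farey_def field_simps)

text \<open>
  The half-open interval \<open>{1/2<..}\<close> matters only for \<open>k = 1\<close>, where it makes the union disjoint.
\<close>

lemma measure_farey_preimage_initial_segment:
  assumes "0 < k"
  shows "measure lborel (farey_preimage (Suc n) {0..1 / real k}) =
    measure lborel (farey_preimage n {0..1 / real (Suc k)}) +
    measure lborel (farey_preimage n ({1/2<..} \<inter> {real k / real (Suc k)..1}))"
proof -
  \<comment> \<open>On the left branch, \<open>x / (1 - x) \<le> 1 / k\<close> means
    \<open>x \<le> 1 / (k + 1)\<close>; on the right one, \<open>(1 - x) / x \<le> 1 / k\<close>
    means \<open>x \<ge> k / (k + 1)\<close>.\<close>
  have step: "farey x \<in> {0..1 / real k} \<longleftrightarrow>
      x \<in> {0..1 / real (Suc k)} \<union> ({1/2<..} \<inter> {real k / real (Suc k)..1})"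
    if "x \<in> {0..1}" for x
  proof (cases "x \<le> 1/2")
    case True
    then show ?thesis using that assms by (auto simp: farey_def field_simps)
  next
    case False
    have "1 / real (Suc k) \<le> 1/2" using assms by (simp add: field_simps)
    then have "x \<notin> {0..1 / real (Suc k)}" using False unfolding atLeastAtMost_iff by linarith
    then show ?thesis using False that assms by (auto simp: farey_def field_simps)
  qed
  note maps = farey_funpow_mem_unit_interval
  have eq: "farey_preimage (Suc n) {0..1 / real k} = farey_preimage n {0..1 / real (Suc k)} \<union>
      farey_preimage n ({1/2<..} \<inter> {real k / real (Suc k)..1})"
    using step maps unfolding farey_preimage_def by auto
  have "1 / real (Suc k) \<le> 1 / 2" using assms by (simp add: field_simps)
  then have "{0..1 / real (Suc k)} \<inter> {1/2<..} = {}" by (intro equals0I) (unfold Int_iff greaterThan_iff atLeastAtMost_iff, linarith)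
  then have disj: "farey_preimage n {0..1 / real (Suc k)} \<inter>
      farey_preimage n ({1/2<..} \<inter> {real k / real (Suc k)..1}) = {}"
    unfolding farey_preimage_def by blast
  show ?thesis
    unfolding eq using disj
    by (intro measure_Union) (auto simp: emeasure_farey_preimage_eq_measure)
qed

text \<open>Term \<open>k\<close> measures the points whose last visit to (1/2, 1] before time
  \<open>n\<close> happens at time \<open>n - k\<close>. The points without such a visit form
  \<open>[0, 1 / (n + 1)]\<close>, whence the left-hand side.\<close>

lemma sum_measure_farey_preimage:
  "real n / real (Suc n) = (\<Sum>k=1..n. measure lborel (farey_preimage (n - k) ({1/2<..} \<inter> {real k / real (Suc k)..1})))"
proof -
  define G where "G n k = measure lborel (farey_preimage n {0..1 / real k})" for n k
  define R where "R n k = measure lborel (farey_preimage n ({1/2<..} \<inter> {real k / real (Suc k)..1}))" for n k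
  have step: "G (Suc n) k = G n (Suc k) + R n k" if "0 < k" for n k
    unfolding G_def R_def using that by (rule measure_farey_preimage_initial_segment)
  have "farey_preimage n {0..1} = {0..1}"
    using farey_funpow_mem_unit_interval unfolding farey_preimage_def by blast
  then have G1: "G n 1 = 1" by (simp add: G_def)
  have G0: "G 0 k = 1 / real k" if "0 < k" for k
  proof -
    have "1 / real k \<le> 1" using that by simp
    then have "farey_preimage 0 {0..1 / real k} = {0..1 / real k}"
      by (auto simp: farey_preimage_def)
    then show ?thesis using that by (simp add: G_def)
  qed
  have "G n 1 = G (n - m) (Suc m) + (\<Sum>k=1..m. R (n - k) k)" if "m \<le> n" for m
    using that
  proof (induction m)
    case (Suc m)
    then have "n - m = Suc (n - Suc m)" by simp
    then have "G (n - m) (Suc m) = G (n - Suc m) (Suc (Suc m)) + R (n - Suc m) (Suc m)"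
      using step by simp
    with Suc show ?case by simp
  qed simp
  from this[of n] have "1 = 1 / real (Suc n) + (\<Sum>k=1..n. R (n - k) k)"
    by (simp only: G1 G0 diff_self_eq_0 zero_less_Suc)
  then show ?thesis unfolding R_def by (simp add: field_simps)
qed

section \<open>Bounds for the density at 1\<close>

lemma sum_ln_Suc_ratio: "(\<Sum>k=1..n. ln (real (Suc k) / real k)) = ln (real (Suc n))"
  by (induction n) (auto simp: ln_div)

text \<open>The interval lies in [1/2, 1], so the values at 1/2 and 1 bound the density; the
  logarithm is its length for \<open>dx / x\<close>.\<close>

lemma measure_farey_preimage_excursion_bounds:
  assumes "0 < k"
  defines "M \<equiv> \<lambda>n. measure lborel (farey_preimage n ({1/2<..} \<inter> {real k / real (Suc k)..1}))"
  shows "farey_density (Suc n) 1 * ln (real (Suc k) / real k) \<le> M n"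
    and "M n \<le> farey_density n 1 * ln (real (Suc k) / real k)"
proof -
  have k: "1/2 \<le> real k / real (Suc k)" using assms by (simp add: field_simps)
  have AE: "AE x in lborel. x \<in> {1/2<..} \<inter> {real k / real (Suc k)..1} \<longleftrightarrow> x \<in> {real k / real (Suc k)..1}"
    using AE_lborel_singleton[of "1/2::real"] by eventually_elim (use k in \<open>unfold Int_iff greaterThan_iff atLeastAtMost_iff, linarith\<close>)
  have "farey_density (Suc n) 1 \<le> farey_density n (real k / real (Suc k))"
    unfolding farey_density_half[symmetric] using k by (intro farey_density_mono) auto
  moreover have "0 \<le> ln (real (Suc k) / real k)" using assms by simp
  moreover have "1 / (real k / real (Suc k)) = real (Suc k) / real k" by simp
  ultimately show "farey_density (Suc n) 1 * ln (real (Suc k) / real k) \<le> M n"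
    "M n \<le> farey_density n 1 * ln (real (Suc k) / real k)"
    using measure_farey_preimage_bounds[OF _ _ _ _ AE, of n] assms(1) unfolding M_def
    by (auto intro: order.trans[OF mult_right_mono])
qed

text \<open>Since \<open>k \<ge> 1\<close>, the index \<open>Suc (n - k)\<close> is at most
  \<open>n\<close>, so every term of the renewal equation is bounded below through the value at
  \<open>n\<close>.\<close>

lemma farey_density_one_upper: "farey_density n 1 * ln (real (Suc n)) \<le> 1"
proof -
  have "farey_density n 1 * ln (real (Suc n)) =
      (\<Sum>k=1..n. farey_density n 1 * ln (real (Suc k) / real k))"
    by (simp only: sum_ln_Suc_ratio[symmetric] sum_distrib_left)
  also have "\<dots> \<le> (\<Sum>k=1..n. measure lborel (farey_preimage (n - k) ({1/2<..} \<inter> {real k / real (Suc k)..1})))"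
  proof (rule sum_mono)
    fix k assume k: "k \<in> {1..n}"
    have "farey_density n 1 * ln (real (Suc k) / real k) \<le>
        farey_density (Suc (n - k)) 1 * ln (real (Suc k) / real k)"
      using k by (intro mult_right_mono farey_density_one_antimono) auto
    also have "\<dots> \<le> measure lborel (farey_preimage (n - k) ({1/2<..} \<inter> {real k / real (Suc k)..1}))"
      using k by (intro measure_farey_preimage_excursion_bounds) auto
    finally show "farey_density n 1 * ln (real (Suc k) / real k) \<le>
        measure lborel (farey_preimage (n - k) ({1/2<..} \<inter> {real k / real (Suc k)..1}))" .
  qed
  also have "\<dots> = real n / real (Suc n)" by (rule sum_measure_farey_preimage[symmetric])
  also have "\<dots> \<le> 1" by simp
  finally show ?thesis .
qed

text \<open>The renewal equation is taken at time \<open>2 * m\<close>: for \<open>k \<le> m\<close>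
  the index \<open>2 * m - k\<close> is at least \<open>m\<close>, and for \<open>k > m\<close> the
  weight is at most \<open>1 / m\<close>.\<close>

lemma farey_density_one_lower:
  assumes "0 < m"
  shows "real (2 * m) / real (Suc (2 * m)) \<le>
    farey_density m 1 * ln (real (Suc m)) + (\<Sum>j<m. farey_density j 1) / m"
proof -
  let ?a = "\<lambda>n. farey_density n 1" and ?w = "\<lambda>k. ln (real (Suc k) / real k)"
  have "real (2 * m) / real (Suc (2 * m)) = (\<Sum>k=1..2*m. measure lborel
      (farey_preimage (2 * m - k) ({1/2<..} \<inter> {real k / real (Suc k)..1})))"
    by (rule sum_measure_farey_preimage)
  also have "\<dots> \<le> (\<Sum>k=1..2*m. ?a (2 * m - k) * ?w k)"
    by (intro sum_mono measure_farey_preimage_excursion_bounds) auto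
  also have "{1..2*m} = {1..m} \<union> {Suc m..2*m}" using assms by auto
  also have "(\<Sum>k\<in>{1..m} \<union> {Suc m..2*m}. ?a (2 * m - k) * ?w k) =
      (\<Sum>k=1..m. ?a (2 * m - k) * ?w k) + (\<Sum>k=Suc m..2*m. ?a (2 * m - k) * ?w k)"
    by (rule sum.union_disjoint) auto
  also have "(\<Sum>k=1..m. ?a (2 * m - k) * ?w k) \<le> (\<Sum>k=1..m. ?a m * ?w k)"
    by (intro sum_mono mult_right_mono farey_density_one_antimono) auto
  also have "\<dots> = ?a m * ln (real (Suc m))"
    by (simp only: sum_ln_Suc_ratio[symmetric] sum_distrib_left)
  also have "(\<Sum>k=Suc m..2*m. ?a (2 * m - k) * ?w k) \<le> (\<Sum>k=Suc m..2*m. ?a (2 * m - k) * (1 / m))"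
  proof (intro sum_mono mult_left_mono)
    fix k assume k: "k \<in> {Suc m..2*m}"
    have "?w k = ln (1 + 1 / real k)" using k by (simp add: field_simps)
    also have "\<dots> \<le> 1 / real k" by (rule ln_add_one_self_le_self) simp
    also have "\<dots> \<le> 1 / m" using k assms by (simp add: field_simps)
    finally show "?w k \<le> 1 / m" .
  qed (auto intro: farey_density_nonneg)
  also have "\<dots> = (\<Sum>j<m. ?a j * (1 / m))"
    by (rule sum.reindex_bij_witness[of _ "\<lambda>j. 2 * m - j" "\<lambda>k. 2 * m - k"]) auto
  finally show ?thesis by (simp add: sum_divide_distrib)
qed

text \<open>The first \<open>r\<close> terms are at most 1 and the others at most
  \<open>1 / ln (r + 1)\<close>; the cut \<open>r\<close> stays free to be optimized.\<close>

lemma sum_farey_density_one_le: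
  assumes "0 < r"
  shows "(\<Sum>j<m. farey_density j 1) \<le> r + m / ln (real (Suc r))"
proof -
  let ?a = "\<lambda>n. farey_density n 1"
  have le1: "?a j \<le> 1" for j using farey_density_one_antimono[of 0 j] by simp
  have "(\<Sum>j<m. ?a j) \<le> (\<Sum>j<m. (if j < r then 1 else 0) + 1 / ln (real (Suc r)))"
  proof (rule sum_mono)
    fix j
    have ln: "ln (real (Suc r)) > 0" using assms by simp
    have "?a j \<le> 1 / ln (real (Suc r))" if "r \<le> j"
      using farey_density_one_upper[of r] farey_density_one_antimono[OF that] ln
      
      by (auto simp: pos_le_divide_eq intro: order.trans[OF mult_right_mono])
    then show "?a j \<le> (if j < r then 1 else 0) + 1 / ln (real (Suc r))"
      using le1[of j] ln by (auto simp: add_increasing2)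
  qed
  also have "\<dots> = card {j. j < m \<and> j < r} + m / ln (real (Suc r))"
    by (simp add: sum.distrib sum.If_cases Int_def)
  also have "\<dots> \<le> r + m / ln (real (Suc r))"
    using card_mono[of "{..<r}" "{j. j < m \<and> j < r}"] by auto
  finally show ?thesis .
qed

section \<open>Calculus of the expansion \<open>1 / ln n + O(1 / (ln n)\<^sup>2)\<close>\<close>

text \<open>An additive form of relative error \<open>O(1 / ln n)\<close>, convenient for
  sandwiching and affine combinations.\<close>

definition log_asymp :: "(nat \<Rightarrow> real) \<Rightarrow> bool" where
  "log_asymp p \<longleftrightarrow> (\<lambda>n. p n - 1 / ln n) \<in> O(\<lambda>n. 1 / (ln n)\<^sup>2)"

text \<open>Shifting the index by one changes \<open>1 / ln n\<close> by less than the allowed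
  error.\<close>

lemma log_asymp_shift:
  assumes "log_asymp p"
  shows "log_asymp (\<lambda>n. p (Suc n))" and "log_asymp (\<lambda>n. p (n - 1))"
proof -
  have "(\<lambda>n. p (Suc n) - 1 / ln (real (Suc n))) \<in> O(\<lambda>n. 1 / (ln (real (Suc n)))\<^sup>2)"
    using landau_o.big.compose[OF assms[unfolded log_asymp_def] filterlim_Suc] by simp
  also have "(\<lambda>n. 1 / (ln (real (Suc n)))\<^sup>2) \<in> O(\<lambda>n. 1 / (ln n)\<^sup>2)"
    unfolding of_nat_Suc by real_asymp
  finally have "(\<lambda>n. p (Suc n) - 1 / ln (real (Suc n)) + (1 / ln (real (Suc n)) - 1 / ln n))
      \<in> O(\<lambda>n. 1 / (ln n)\<^sup>2)"
    by (rule sum_in_bigo) (unfold of_nat_Suc, real_asymp)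
  then show "log_asymp (\<lambda>n. p (Suc n))" unfolding log_asymp_def by simp
  have lim: "filterlim (\<lambda>n. n - 1) sequentially (sequentially :: nat filter)"
    by (rule filterlim_minus_const_nat_at_top)
  have "(\<lambda>n. p (n - 1) - 1 / ln (real (n - 1))) \<in> O(\<lambda>n. 1 / (ln (real (n - 1)))\<^sup>2)"
    using landau_o.big.compose[OF assms[unfolded log_asymp_def] lim] by simp
  also have "(\<lambda>n. 1 / (ln (real (n - 1)))\<^sup>2) \<in> O(\<lambda>n. 1 / (ln n)\<^sup>2)"
    by real_asymp
  finally have "(\<lambda>n. p (n - 1) - 1 / ln (real (n - 1)) + (1 / ln (real (n - 1)) - 1 / ln n))
      \<in> O(\<lambda>n. 1 / (ln n)\<^sup>2)"
    by (rule sum_in_bigo) real_asymp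
  then show "log_asymp (\<lambda>n. p (n - 1))" unfolding log_asymp_def by simp
qed

text \<open>The coefficients add up to 1, which preserves the main term; \<open>c\<close> may exceed
  1, as it does when the recursion is solved backwards.\<close>

lemma log_asymp_affine:
  assumes "log_asymp p" "log_asymp q"
  shows "log_asymp (\<lambda>n. c * p n + (1 - c) * q n)"
proof -
  have "(\<lambda>n. c * (p n - 1 / ln n) + (1 - c) * (q n - 1 / ln n)) \<in> O(\<lambda>n. 1 / (ln n)\<^sup>2)"
    using assms unfolding log_asymp_def by (intro sum_in_bigo) auto
  also have "(\<lambda>n. c * (p n - 1 / ln n) + (1 - c) * (q n - 1 / ln n)) =
      (\<lambda>n. c * p n + (1 - c) * q n - 1 / ln n)"
    by (simp add: fun_eq_iff right_diff_distrib left_diff_distrib diff_divide_distrib)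
  finally show ?thesis unfolding log_asymp_def .
qed

lemma log_asymp_sandwich:
  assumes "log_asymp l" "log_asymp u"
    and "eventually (\<lambda>n. l n \<le> p n) at_top" "eventually (\<lambda>n. p n \<le> u n) at_top"
  shows "log_asymp p"
proof -
  have "(\<lambda>n. p n - 1 / ln n) \<in> O(\<lambda>n. \<bar>l n - 1 / ln n\<bar> + \<bar>u n - 1 / ln n\<bar>)"
    by (rule landau_o.big_mono) (use assms(3,4) in \<open>eventually_elim, simp\<close>)
  also have "(\<lambda>n. \<bar>l n - 1 / ln n\<bar> + \<bar>u n - 1 / ln n\<bar>) \<in> O(\<lambda>n. 1 / (ln n)\<^sup>2)"
    using assms(1,2) unfolding log_asymp_def by (intro sum_in_bigo) auto
  finally show ?thesis unfolding log_asymp_def .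
qed

section \<open>Expansion of the densities at 1 and at the points 1/k\<close>

lemma log_asymp_farey_density_one: "log_asymp (\<lambda>n. farey_density n 1)"
proof (rule log_asymp_sandwich)
  \<comment> \<open>With a cut near \<open>sqrt m\<close>, the first \<open>r m\<close> terms
    contribute little after division by \<open>m\<close>, while \<open>ln (r m)\<close> is still at
    least half of \<open>ln m\<close>.\<close>
  define r where "r m = nat \<lceil>sqrt (real m)\<rceil>" for m
  \<comment> \<open>The lower bound solved for the value at 1, with the ceiling replaced by
    \<open>sqrt m + 1\<close> and \<open>ln (r m + 1)\<close> by \<open>ln m / 2\<close>, so that it
    is an explicit function of \<open>m\<close>.\<close>
  define l where "l m = (real (2 * m) / real (Suc (2 * m))
    - (sqrt m + 1 + m / (ln m / 2)) / m) / ln (real (Suc m))" for m :: nat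
  show "log_asymp l"
    unfolding log_asymp_def l_def of_nat_Suc of_nat_mult by real_asymp
  show "log_asymp (\<lambda>n. 1 / ln (real (Suc n)))"
    unfolding log_asymp_def of_nat_Suc by real_asymp
  show "eventually (\<lambda>n. farey_density n 1 \<le> 1 / ln (real (Suc n))) at_top"
    using eventually_gt_at_top[of 0]
    by eventually_elim (use farey_density_one_upper in \<open>simp add: pos_le_divide_eq\<close>)
  show "eventually (\<lambda>n. l n \<le> farey_density n 1) at_top"
    using eventually_gt_at_top[of 1]
  proof eventually_elim
    fix m :: nat assume m: "1 < m"
    have r: "sqrt m \<le> r m" "r m \<le> sqrt m + 1"
      unfolding r_def using real_sqrt_ge_zero[of "real m"] by linarith+
    have "0 < sqrt m" using m by simp
    then have r0: "0 < r m" using r by linarith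
    have "ln m / 2 = ln (sqrt m)" using m by (simp add: ln_sqrt)
    also have "\<dots> \<le> ln (real (Suc (r m)))" using r \<open>0 < sqrt m\<close> by (intro ln_mono) auto
    finally have ln: "ln m / 2 \<le> ln (real (Suc (r m)))" .
    have ln0: "0 < ln m" using m by simp
    have "(\<Sum>j<m. farey_density j 1) \<le> r m + m / ln (real (Suc (r m)))"
      by (rule sum_farey_density_one_le) fact
    also have "\<dots> \<le> sqrt m + 1 + m / (ln m / 2)"
      using r r0 ln ln0 by (intro add_mono divide_left_mono mult_pos_pos) auto
    finally have "(\<Sum>j<m. farey_density j 1) / m \<le> (sqrt m + 1 + m / (ln m / 2)) / m"
      by (rule divide_right_mono) simp
    with farey_density_one_lower[of m] m
    have "real (2 * m) / real (Suc (2 * m)) - (sqrt m + 1 + m / (ln m / 2)) / m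
        \<le> farey_density m 1 * ln (real (Suc m))" by linarith
    then show "l m \<le> farey_density m 1"
      unfolding l_def using m by (subst pos_divide_le_eq) auto
  qed
qed

text \<open>The inverse branches send \<open>1 / (k + 1)\<close> to \<open>1 / (k + 2)\<close> and
  to \<open>y = (k + 1) / (k + 2)\<close>. As \<open>y\<close> lies in [1/2, 1], its density is
  already controlled, and the recursion is solved for the other value.\<close>

lemma log_asymp_farey_density_inverse: "log_asymp (\<lambda>n. farey_density n (1 / real (Suc k)))"
proof (induction k)
  case 0
  show ?case using log_asymp_farey_density_one by simp
next
  case (Suc k)
  define y where "y = real (Suc k) / real (Suc (Suc k))"
  have y: "1/2 \<le> y" "y \<le> 1" by (auto simp: y_def field_simps)
  have "log_asymp (\<lambda>n. farey_density n y)"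
  proof (rule log_asymp_sandwich)
    show "log_asymp (\<lambda>n. farey_density (Suc n) 1)" "log_asymp (\<lambda>n. farey_density n 1)"
      using log_asymp_farey_density_one log_asymp_shift by blast+
    show "\<forall>\<^sub>F n in at_top. farey_density (Suc n) 1 \<le> farey_density n y"
      unfolding farey_density_half[symmetric] using y by (intro always_eventually allI farey_density_mono) auto
    show "\<forall>\<^sub>F n in at_top. farey_density n y \<le> farey_density n 1"
      using y by (intro always_eventually allI farey_density_mono) auto
  qed
  moreover have "log_asymp (\<lambda>n. farey_density (Suc n) (1 / real (Suc k)))"
    using Suc log_asymp_shift by blast
  ultimately have "log_asymp (\<lambda>n. (real (Suc (Suc k)) / real (Suc k)) * farey_density (Suc n) (1 / real (Suc k))
      + (1 - real (Suc (Suc k)) / real (Suc k)) * farey_density n y)"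
    by (intro log_asymp_affine)
  moreover have "(real (Suc (Suc k)) / real (Suc k)) * farey_density (Suc n) (1 / real (Suc k))
      + (1 - real (Suc (Suc k)) / real (Suc k)) * farey_density n y
      = farey_density n (1 / real (Suc (Suc k)))" for n
  proof -
    define a where "a = real (Suc k)"
    have a: "a > 0" by (simp add: a_def)
    have eqs: "(1 / a) / (1 + 1 / a) = 1 / (a + 1)" "1 / (1 + 1 / a) = a / (a + 1)"
      using a by (auto simp: field_simps)
    have "farey_density (Suc n) (1 / a) =
        (farey_density n (1 / (a + 1)) + 1 / a * farey_density n (a / (a + 1))) / (1 + 1 / a)"
      by (simp only: farey_density.simps eqs)
    moreover have "real (Suc (Suc k)) = a + 1" by (simp add: a_def)
    ultimately show ?thesis
      unfolding y_def a_def[symmetric] using a by (simp add: divide_simps) (simp add: algebra_simps)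
  qed
  ultimately show ?case by simp
qed

section \<open>Passage to intervals\<close>

text \<open>The quotient is a \<open>dx / x\<close> average of the density over the interval, hence
  lies between its values at some \<open>1 / (k + 1) < \<alpha>\<close> and at 1.\<close>

lemma log_asymp_measure_farey_preimage:
  assumes "0 < \<alpha>" "\<alpha> < \<beta>" "\<beta> \<le> 1"
  shows "log_asymp (\<lambda>n. measure lborel (farey_preimage n {\<alpha>..\<beta>}) / ln (\<beta> / \<alpha>))"
proof -
  obtain k where k: "1 / real (Suc k) < \<alpha>" 
    using nat_approx_posE[OF assms(1)] by blast
  have ln: "0 < ln (\<beta> / \<alpha>)" using assms by simp
  have bounds: "farey_density n \<alpha> * ln (\<beta> / \<alpha>) \<le> measure lborel (farey_preimage n {\<alpha>..\<beta>})"
    "measure lborel (farey_preimage n {\<alpha>..\<beta>}) \<le> farey_density n \<beta> * ln (\<beta> / \<alpha>)" for n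
    using measure_farey_preimage_bounds[of \<alpha> \<beta> "{\<alpha>..\<beta>}" n] assms by auto
  show ?thesis
  proof (rule log_asymp_sandwich[OF log_asymp_farey_density_inverse[of k] log_asymp_farey_density_one])
    show "\<forall>\<^sub>F n in at_top. farey_density n (1 / real (Suc k)) \<le> measure lborel (farey_preimage n {\<alpha>..\<beta>}) / ln (\<beta> / \<alpha>)"
    proof (intro always_eventually allI)
      fix n
      have "farey_density n (1 / real (Suc k)) \<le> farey_density n \<alpha>"
        using k assms by (intro farey_density_mono) auto
      also have "\<dots> \<le> measure lborel (farey_preimage n {\<alpha>..\<beta>}) / ln (\<beta> / \<alpha>)"
        using bounds(1) ln by (simp add: pos_le_divide_eq)
      finally show "farey_density n (1 / real (Suc k)) \<le> measure lborel (farey_preimage n {\<alpha>..\<beta>}) / ln (\<beta> / \<alpha>)" .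
    qed
    show "\<forall>\<^sub>F n in at_top. measure lborel (farey_preimage n {\<alpha>..\<beta>}) / ln (\<beta> / \<alpha>) \<le> farey_density n 1"
    proof (intro always_eventually allI)
      fix n
      have "measure lborel (farey_preimage n {\<alpha>..\<beta>}) / ln (\<beta> / \<alpha>) \<le> farey_density n \<beta>"
        using bounds(2) ln by (simp add: pos_divide_le_eq)
      also have "\<dots> \<le> farey_density n 1"
        using assms by (intro farey_density_mono) auto
      finally show "measure lborel (farey_preimage n {\<alpha>..\<beta>}) / ln (\<beta> / \<alpha>) \<le> farey_density n 1" .
    qed
  qed
qed

theorem theorem1:
  fixes \<alpha> \<beta> :: real
  assumes "0 < \<alpha>" and "\<alpha> < \<beta>" and "\<beta> \<le> 1"
  shows "\<exists>e :: nat \<Rightarrow> real. e \<in> O(\<lambda>n. 1 / ln (real n)) \<and>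
           (\<forall>\<^sub>F n in at_top.
              measure lborel (farey_preimage (n - 1) {\<alpha>..\<beta>})
                = ln (\<beta> / \<alpha>) / ln (real n) * (1 + e n))"
proof -
  define p where "p n = measure lborel (farey_preimage (n - 1) {\<alpha>..\<beta>}) / ln (\<beta> / \<alpha>)" for n
  \<comment> \<open>The additive error of \<open>p\<close> multiplied by \<open>ln n\<close>, which
    makes it relative.\<close>
  define e where "e n = ln (real n) * (p n - 1 / ln (real n))" for n
  have ln: "0 < ln (\<beta> / \<alpha>)" using assms by simp
  have "log_asymp p"
    unfolding p_def using log_asymp_shift(2)[OF log_asymp_measure_farey_preimage[OF assms]] .
  then have "e \<in> O(\<lambda>n. ln (real n) * (1 / (ln (real n))\<^sup>2))"
    unfolding e_def log_asymp_def by (intro landau_o.big.mult_left)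
  \<comment> \<open>This holds even where the logarithm vanishes, since division by zero makes both
    sides 0.\<close>
  also have "(\<lambda>n. ln (real n) * (1 / (ln (real n))\<^sup>2)) = (\<lambda>n::nat. 1 / ln (real n))"
    by (simp add: fun_eq_iff power2_eq_square)
  finally have "e \<in> O(\<lambda>n. 1 / ln (real n))" .
  moreover have "\<forall>\<^sub>F n in at_top. measure lborel (farey_preimage (n - 1) {\<alpha>..\<beta>})
                = ln (\<beta> / \<alpha>) / ln (real n) * (1 + e n)"
    using eventually_gt_at_top[of 1]
  proof eventually_elim
    fix n :: nat assume "1 < n"
    then have "0 < ln (real n)" by simp
    then have "1 + e n = ln (real n) * p n" by (simp add: e_def right_diff_distrib)
    then show "measure lborel (farey_preimage (n - 1) {\<alpha>..\<beta>})
        = ln (\<beta> / \<alpha>) / ln (real n) * (1 + e n)"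
      using \<open>0 < ln (real n)\<close> ln by (simp add: p_def)
  qed
  ultimately show ?thesis by blast
qed

end
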